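(* Let $(\mathscr{G},\{\cdot_\lambda\}_{\lambda\in\Lambda},\{\circ_\lambda\}_{\lambda\in\Lambda})$ be a dynamical skew brace, $\mathscr{G}=(G,\Lambda,\phi_G)$. Define $\vartriangleright_\lambda:G\times G\to G$ by $$a\vartriangleright_\lambda b:=a^\lambda\cdot_\lambda(a\circ_\lambda b),\quad a,b\in G,$$ where $a^\lambda$ is the inverse of $a$ for $\cdot_\lambda$. Then $(\mathscr{G},\{\cdot_\lambda\}_{\lambda\in\Lambda},\{\vartriangleright_\lambda\}_{\lambda\in\Lambda})$ is a dynamical post-group. If $\Psi$ is a homomorphism of dynamical skew braces from $(\mathscr{G},\{\cdot_\lambda\},\{\circ_\lambda\})$ to $(\mathscr{H},\{\cdot'_\lambda\},\{\circ'_\lambda\})$, then $\Psi$ is a homomorphism of the corresponding dynamical post-groups from $(\mathscr{G},\{\cdot_\lambda\},\{\vartriangleright_\lambda\})$ to $(\mathscr{H},\{\cdot'_\lambda\},\{\vartriangleright'_\lambda\})$.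
   Context: Fix a non-empty set $\Lambda$. A dynamical set is a triple $\mathscr{X}=(X,\Lambda,\phi_X)$ with $X$ a set and $\phi_X:\Lambda\times X\to\Lambda$ a map. A morphism $\mathscr{X}\to\mathscr{Y}$ is a map $f:\Lambda\times X\to Y$, $f_\lambda=f(\lambda,-)$, with $\phi_Y(\lambda,f_\lambda(x))=\phi_X(\lambda,x)$. Dynamical group: a dynamical set $\mathscr{G}=(G,\Lambda,\phi_G)$ with maps $\circ_\lambda:G\times G\to G$ such that $\phi_G(\lambda,a\circ_\lambda b)=\phi_G(\phi_G(\lambda,a),b)$ and $a\circ_\lambda(b\circ_{\phi_G(\lambda,a)}c)=(a\circ_\lambda b)\circ_\lambda c$; an element $e_G$ with $a\circ_\lambda e_G=e_G\circ_\lambda a=a$ and $\phi_G(\lambda,e_G)=\lambda$; and for all $\lambda,a$ an element $\bar a^\lambda$ with $a\circ_\lambda\bar a^\lambda=\bar a^\lambda\circ_{\phi_G(\lambda,a)}a=e_G$. A constant dynamical group is a family of group structures $\cdot_\lambda$ ($\lambda\in\Lambda$) on one set with a common unit. Dynamical skew brace $(\mathscr{G},\{\cdot_\lambda\},\{\circ_\lambda\})$: $(G,\Lambda,\{\cdot_\lambda\})$ is a constant dynamical group, $(\mathscr{G},\{\circ_\lambda\})$ is a dynamical group, and $a\circ_\lambda(b\cdot_{\phi_G(\lambda,a)}c)=(a\circ_\lambda b)\cdot_\lambda a^\lambda\cdot_\lambda(a\circ_\lambda c)$ for all $\lambda,a,b,c$. A homomorphism of dynamical skew braces is a morphism of dynamical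 sets $\Psi:\mathscr{G}\to\mathscr{H}$ with $\Psi_\lambda(a\cdot_\lambda b)=\Psi_\lambda(a)\cdot'_\lambda\Psi_\lambda(b)$ and $\Psi_\lambda(a\circ_\lambda b)=\Psi_\lambda(a)\circ'_\lambda\Psi_{\phi_G(\lambda,a)}(b)$. Dynamical post-group: a dynamical set $\mathscr{G}=(G,\Lambda,\phi_G)$ with maps $\cdot_\lambda,\vartriangleright_\lambda:G\times G\to G$ such that $(G,\Lambda,\{\cdot_\lambda\})$ is a constant dynamical group; $a\vartriangleright_\lambda(b\cdot_{\phi_G(\lambda,a)}c)=(a\vartriangleright_\lambda b)\cdot_\lambda(a\vartriangleright_\lambda c)$; $(a\cdot_\lambda(a\vartriangleright_\lambda b))\vartriangleright_\lambda c=a\vartriangleright_\lambda(b\vartriangleright_{\phi_G(\lambda,a)}c)$; and each map $b\mapsto a\vartriangleright_\lambda b$ is bijective. A homomorphism of dynamical post-groups is a morphism of dynamical sets $\Psi$ with $\Psi_\lambda(a\cdot_\lambda b)=\Psi_\lambda(a)\cdot'_\lambda\Psi_\lambda(b)$ and $\Psi_\lambda(a\vartriangleright_\lambda b)=\Psi_\lambda(a)\vartriangleright'_\lambda\Psi_{\phi_G(\lambda,a)}(b)$. *)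

theory Defs
  imports "HOL-Algebra.Group"
begin

text \<open>
  All maps are curried: \<open>\<phi> l x\<close> is $\phi(\lambda,x)$, \<open>circ l a b\<close> is $a\circ_\lambda b$, and
  \<open>\<Psi> l x\<close> is $\Psi_\lambda(x)$. The parameter set \<open>\<Lambda>\<close> and the underlying sets are explicit carriers,
  so every law is relativised to them.
\<close>

locale parameter_set =
  fixes \<Lambda> :: "'l set"
  assumes nonempty: "\<Lambda> \<noteq> {}"

locale dynamical_set = parameter_set \<Lambda>
  for \<Lambda> :: "'l set" +
  fixes X :: "'a set" and \<phi> :: "'l \<Rightarrow> 'a \<Rightarrow> 'l"
  assumes phi_closed: "\<lbrakk>l \<in> \<Lambda>; x \<in> X\<rbrakk> \<Longrightarrow> \<phi> l x \<in> \<Lambda>"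

locale dynamical_set_morphism =
  source: dynamical_set \<Lambda> X \<phi> + target: dynamical_set \<Lambda> Y \<phi>'
  for \<Lambda> :: "'l set"
    and X :: "'a set" and \<phi> :: "'l \<Rightarrow> 'a \<Rightarrow> 'l"
    and Y :: "'b set" and \<phi>' :: "'l \<Rightarrow> 'b \<Rightarrow> 'l" +
  fixes f :: "'l \<Rightarrow> 'a \<Rightarrow> 'b"
  assumes map_closed: "\<lbrakk>l \<in> \<Lambda>; x \<in> X\<rbrakk> \<Longrightarrow> f l x \<in> Y"
    and map_phi: "\<lbrakk>l \<in> \<Lambda>; x \<in> X\<rbrakk> \<Longrightarrow> \<phi>' l (f l x) = \<phi> l x"

locale dynamical_group = dynamical_set \<Lambda> G \<phi>
  for \<Lambda> :: "'l set" and G :: "'a set" and \<phi> :: "'l \<Rightarrow> 'a \<Rightarrow> 'l" +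
  fixes circ :: "'l \<Rightarrow> 'a \<Rightarrow> 'a \<Rightarrow> 'a"
  assumes circ_closed: "\<lbrakk>l \<in> \<Lambda>; a \<in> G; b \<in> G\<rbrakk> \<Longrightarrow> circ l a b \<in> G"
    and phi_circ: "\<lbrakk>l \<in> \<Lambda>; a \<in> G; b \<in> G\<rbrakk> \<Longrightarrow> \<phi> l (circ l a b) = \<phi> (\<phi> l a) b"
    and circ_assoc: "\<lbrakk>l \<in> \<Lambda>; a \<in> G; b \<in> G; c \<in> G\<rbrakk> \<Longrightarrow>
      circ l a (circ (\<phi> l a) b c) = circ l (circ l a b) c"
    and circ_unit_inverse: "\<exists>e\<in>G.
      (\<forall>l\<in>\<Lambda>. \<phi> l e = l \<and> (\<forall>a\<in>G. circ l a e = a \<and> circ l e a = a)) \<and>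
      (\<forall>l\<in>\<Lambda>. \<forall>a\<in>G. \<exists>b\<in>G. circ l a b = e \<and> circ (\<phi> l a) b a = e)"

text \<open>
  The group structure with product $\cdot_\lambda$ is the record \<open>D l\<close>; in particular
  $a^\lambda$ is \<open>inv\<^bsub>D l\<^esub> a\<close>.
\<close>

locale constant_dynamical_group = parameter_set \<Lambda>
  for \<Lambda> :: "'l set" +
  fixes G :: "'a set" and D :: "'l \<Rightarrow> 'a monoid"
  assumes group_D: "l \<in> \<Lambda> \<Longrightarrow> group (D l)"
    and carrier_D: "l \<in> \<Lambda> \<Longrightarrow> carrier (D l) = G"
    and common_unit: "\<lbrakk>l \<in> \<Lambda>; m \<in> \<Lambda>\<rbrakk> \<Longrightarrow> \<one>\<^bsub>D l\<^esub> = \<one>\<^bsub>D m\<^esub>"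

locale dynamical_skew_brace =
  constant_dynamical_group \<Lambda> G D + dynamical_group \<Lambda> G \<phi> circ
  for \<Lambda> :: "'l set" and G :: "'a set" and \<phi> :: "'l \<Rightarrow> 'a \<Rightarrow> 'l"
    and D :: "'l \<Rightarrow> 'a monoid" and circ :: "'l \<Rightarrow> 'a \<Rightarrow> 'a \<Rightarrow> 'a" +
  assumes skew_distrib: "\<lbrakk>l \<in> \<Lambda>; a \<in> G; b \<in> G; c \<in> G\<rbrakk> \<Longrightarrow>
    circ l a (b \<otimes>\<^bsub>D (\<phi> l a)\<^esub> c) = circ l a b \<otimes>\<^bsub>D l\<^esub> inv\<^bsub>D l\<^esub> a \<otimes>\<^bsub>D l\<^esub> circ l a c"

locale dynamical_skew_brace_hom =
  source: dynamical_skew_brace \<Lambda> G \<phi> D circ +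
  target: dynamical_skew_brace \<Lambda> H \<phi>' D' circ' +
  dynamical_set_morphism \<Lambda> G \<phi> H \<phi>' \<Psi>
  for \<Lambda> :: "'l set"
    and G :: "'a set" and \<phi> :: "'l \<Rightarrow> 'a \<Rightarrow> 'l"
    and D :: "'l \<Rightarrow> 'a monoid" and circ :: "'l \<Rightarrow> 'a \<Rightarrow> 'a \<Rightarrow> 'a"
    and H :: "'b set" and \<phi>' :: "'l \<Rightarrow> 'b \<Rightarrow> 'l"
    and D' :: "'l \<Rightarrow> 'b monoid" and circ' :: "'l \<Rightarrow> 'b \<Rightarrow> 'b \<Rightarrow> 'b"
    and \<Psi> :: "'l \<Rightarrow> 'a \<Rightarrow> 'b" +
  assumes hom_mult: "\<lbrakk>l \<in> \<Lambda>; a \<in> G; b \<in> G\<rbrakk> \<Longrightarrow>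
      \<Psi> l (a \<otimes>\<^bsub>D l\<^esub> b) = \<Psi> l a \<otimes>\<^bsub>D' l\<^esub> \<Psi> l b"
    and hom_circ: "\<lbrakk>l \<in> \<Lambda>; a \<in> G; b \<in> G\<rbrakk> \<Longrightarrow>
      \<Psi> l (circ l a b) = circ' l (\<Psi> l a) (\<Psi> (\<phi> l a) b)"

locale dynamical_post_group =
  constant_dynamical_group \<Lambda> G D + dynamical_set \<Lambda> G \<phi>
  for \<Lambda> :: "'l set" and G :: "'a set" and \<phi> :: "'l \<Rightarrow> 'a \<Rightarrow> 'l"
    and D :: "'l \<Rightarrow> 'a monoid" +
  fixes tri :: "'l \<Rightarrow> 'a \<Rightarrow> 'a \<Rightarrow> 'a"
  assumes tri_closed: "\<lbrakk>l \<in> \<Lambda>; a \<in> G; b \<in> G\<rbrakk> \<Longrightarrow> tri l a b \<in> G"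
    and tri_mult: "\<lbrakk>l \<in> \<Lambda>; a \<in> G; b \<in> G; c \<in> G\<rbrakk> \<Longrightarrow>
      tri l a (b \<otimes>\<^bsub>D (\<phi> l a)\<^esub> c) = tri l a b \<otimes>\<^bsub>D l\<^esub> tri l a c"
    and tri_action: "\<lbrakk>l \<in> \<Lambda>; a \<in> G; b \<in> G; c \<in> G\<rbrakk> \<Longrightarrow>
      tri l (a \<otimes>\<^bsub>D l\<^esub> tri l a b) c = tri l a (tri (\<phi> l a) b c)"
    and tri_bij: "\<lbrakk>l \<in> \<Lambda>; a \<in> G\<rbrakk> \<Longrightarrow> bij_betw (tri l a) G G"

locale dynamical_post_group_hom =
  source: dynamical_post_group \<Lambda> G \<phi> D tri +
  target: dynamical_post_group \<Lambda> H \<phi>' D' tri' +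
  dynamical_set_morphism \<Lambda> G \<phi> H \<phi>' \<Psi>
  for \<Lambda> :: "'l set"
    and G :: "'a set" and \<phi> :: "'l \<Rightarrow> 'a \<Rightarrow> 'l"
    and D :: "'l \<Rightarrow> 'a monoid" and tri :: "'l \<Rightarrow> 'a \<Rightarrow> 'a \<Rightarrow> 'a"
    and H :: "'b set" and \<phi>' :: "'l \<Rightarrow> 'b \<Rightarrow> 'l"
    and D' :: "'l \<Rightarrow> 'b monoid" and tri' :: "'l \<Rightarrow> 'b \<Rightarrow> 'b \<Rightarrow> 'b"
    and \<Psi> :: "'l \<Rightarrow> 'a \<Rightarrow> 'b" +
  assumes hom_mult: "\<lbrakk>l \<in> \<Lambda>; a \<in> G; b \<in> G\<rbrakk> \<Longrightarrow>
      \<Psi> l (a \<otimes>\<^bsub>D l\<^esub> b) = \<Psi> l a \<otimes>\<^bsub>D' l\<^esub> \<Psi> l b"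
    and hom_tri: "\<lbrakk>l \<in> \<Lambda>; a \<in> G; b \<in> G\<rbrakk> \<Longrightarrow>
      \<Psi> l (tri l a b) = tri' l (\<Psi> l a) (\<Psi> (\<phi> l a) b)"

definition brace_tri ::
  "('l \<Rightarrow> 'a monoid) \<Rightarrow> ('l \<Rightarrow> 'a \<Rightarrow> 'a \<Rightarrow> 'a) \<Rightarrow> 'l \<Rightarrow> 'a \<Rightarrow> 'a \<Rightarrow> 'a"
  where "brace_tri D circ l a b = inv\<^bsub>D l\<^esub> a \<otimes>\<^bsub>D l\<^esub> circ l a b"

end

theory Submission
  imports Defs
begin

text \<open>
  The operation $a \vartriangleright_\lambda {-}$ is $a \circ_\lambda {-}$ followed by a left
  translation of $\cdot_\lambda$, so it is bijective, and the skew brace axiom says that it is a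
  group homomorphism from $\cdot_{\phi(\lambda,a)}$ to $\cdot_\lambda$. Moreover
  $a \cdot_\lambda (a \vartriangleright_\lambda b) = a \circ_\lambda b$, so the remaining axiom
  reduces to associativity of $\circ$.
\<close>

lemma (in constant_dynamical_group) D_closed [simp]:
  assumes "l \<in> \<Lambda>" "a \<in> G"
  shows "inv\<^bsub>D l\<^esub> a \<in> G" and "b \<in> G \<Longrightarrow> a \<otimes>\<^bsub>D l\<^esub> b \<in> G"
proof -
  interpret group "D l"
    using assms(1) by (rule group_D)
  show "inv\<^bsub>D l\<^esub> a \<in> G" and "b \<in> G \<Longrightarrow> a \<otimes>\<^bsub>D l\<^esub> b \<in> G"
    using assms inv_closed m_closed by (simp_all add: carrier_D)
qed

lemma (in constant_dynamical_group) left_translation_bij: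
  assumes "l \<in> \<Lambda>" "a \<in> G"
  shows "bij_betw (\<lambda>x. a \<otimes>\<^bsub>D l\<^esub> x) G G"
proof -
  interpret group "D l"
    using assms(1) by (rule group_D)
  have "inj_on (\<lambda>x. a \<otimes>\<^bsub>D l\<^esub> x) G" "(\<lambda>x. a \<otimes>\<^bsub>D l\<^esub> x) ` G = G"
    using inj_on_cmult[of a] surj_const_mult[of a] assms by (simp_all add: carrier_D)
  then show ?thesis
    by (simp add: bij_betw_def)
qed

text \<open>If \<open>b\<close> is the inverse of \<open>a\<close> at \<open>l\<close>, then
  \<open>circ (\<phi> l a) b\<close> is a two-sided inverse of \<open>circ l a\<close>: by
  associativity both composites are translations by the unit.\<close>

lemma (in dynamical_group) circ_bij:
  assumes l: "l \<in> \<Lambda>" and a: "a \<in> G"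
  shows "bij_betw (circ l a) G G"
proof -
  obtain e where e: "\<And>l. l \<in> \<Lambda> \<Longrightarrow> \<phi> l e = l" "\<And>l a. l \<in> \<Lambda> \<Longrightarrow> a \<in> G \<Longrightarrow> circ l e a = a"
    and inv: "\<And>l a. l \<in> \<Lambda> \<Longrightarrow> a \<in> G \<Longrightarrow> \<exists>b\<in>G. circ l a b = e \<and> circ (\<phi> l a) b a = e"
    using circ_unit_inverse by blast
  obtain b where b: "b \<in> G" "circ l a b = e" "circ (\<phi> l a) b a = e"
    using inv[OF l a] by blast
  let ?m = "\<phi> l a"
  have m: "?m \<in> \<Lambda>"
    using l a by (rule phi_closed)
  \<comment> \<open>Since \<open>circ l a b = e\<close> and \<open>e\<close> fixes the parameter,
    \<open>b\<close> leads from \<open>?m\<close> back to \<open>l\<close>. This makes associativity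
    at \<open>?m\<close> applicable to \<open>circ ?m b (circ l a c)\<close>.\<close>
  have ret: "\<phi> ?m b = l"
    using phi_circ[OF l a b(1)] e(1)[OF l] b(2) by simp
  show ?thesis
  proof (rule bij_betw_byWitness[where f' = "circ ?m b"])
    show "\<forall>c\<in>G. circ ?m b (circ l a c) = c"
      using circ_assoc[OF m b(1) a] ret b(3) e(2)[OF m] by simp
    show "\<forall>c\<in>G. circ l a (circ ?m b c) = c"
      using circ_assoc[OF l a b(1)] b(2) e(2)[OF l] by simp
  qed (use circ_closed l a m b(1) in auto)
qed

context dynamical_skew_brace
begin

lemma brace_tri_closed:
  assumes "l \<in> \<Lambda>" "a \<in> G" "b \<in> G"
  shows "brace_tri D circ l a b \<in> G"
  using assms by (simp add: brace_tri_def circ_closed)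

lemma mult_brace_tri:
  assumes "l \<in> \<Lambda>" "a \<in> G" "b \<in> G"
  shows "a \<otimes>\<^bsub>D l\<^esub> brace_tri D circ l a b = circ l a b"
proof -
  interpret group "D l"
    using assms(1) by (rule group_D)
  show ?thesis
    using assms circ_closed[OF assms]
    by (simp add: brace_tri_def carrier_D inv_closed m_assoc[symmetric])
qed

lemma brace_tri_mult:
  assumes l: "l \<in> \<Lambda>" and a: "a \<in> G" and b: "b \<in> G" and c: "c \<in> G"
  shows "brace_tri D circ l a (b \<otimes>\<^bsub>D (\<phi> l a)\<^esub> c)
    = brace_tri D circ l a b \<otimes>\<^bsub>D l\<^esub> brace_tri D circ l a c"
proof -
  interpret group "D l"
    using l by (rule group_D)
  \<comment> \<open>Multiplying the skew brace law on the left by the inverse of \<open>a\<close> in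
    \<open>D l\<close> and reassociating splits the right side into the two required
    factors.\<close>
  show ?thesis
    using l a circ_closed[OF l a b] circ_closed[OF l a c]
    by (simp add: brace_tri_def skew_distrib[OF l a b c] carrier_D inv_closed m_closed m_assoc)
qed

text \<open>Gives access to \<open>hom_inv\<close>: inverses in \<open>D (\<phi> l a)\<close> are
  carried to inverses in \<open>D l\<close>.\<close>

lemma brace_tri_group_hom:
  assumes "l \<in> \<Lambda>" "a \<in> G"
  shows "group_hom (D (\<phi> l a)) (D l) (brace_tri D circ l a)"
  using assms phi_closed[OF assms]
  by (intro group_hom.intro group_hom_axioms.intro homI)
    (simp_all add: group_D carrier_D brace_tri_closed brace_tri_mult)

lemma brace_tri_action:
  assumes l: "l \<in> \<Lambda>" and a: "a \<in> G" and b: "b \<in> G" and c: "c \<in> G"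
  shows "brace_tri D circ l (a \<otimes>\<^bsub>D l\<^esub> brace_tri D circ l a b) c
    = brace_tri D circ l a (brace_tri D circ (\<phi> l a) b c)"
proof -
  let ?m = "\<phi> l a" and ?t = "brace_tri D circ"
  have m: "?m \<in> \<Lambda>"
    using l a by (rule phi_closed)
  have bc: "circ ?m b c \<in> G"
    using m b c by (rule circ_closed)
  interpret group "D l"
    using l by (rule group_D)
  interpret t: group_hom "D ?m" "D l" "?t l a"
    using l a by (rule brace_tri_group_hom)
  have carr: "a \<in> carrier (D l)" "?t l a b \<in> carrier (D l)" "?t l a (circ ?m b c) \<in> carrier (D l)"
    using l a b bc by (simp_all add: carrier_D brace_tri_closed)
  \<comment> \<open>The first argument equals \<open>circ l a b\<close>. The unfolding is restricted
    to that argument, so that \<open>?t l a\<close> stays folded for the homomorphism step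
    below.\<close>
  have "?t l (a \<otimes>\<^bsub>D l\<^esub> ?t l a b) c = inv\<^bsub>D l\<^esub> (a \<otimes>\<^bsub>D l\<^esub> ?t l a b) \<otimes>\<^bsub>D l\<^esub> circ l a (circ ?m b c)"
    using circ_assoc[OF l a b c] by (simp add: mult_brace_tri[OF l a b] brace_tri_def[of D circ l "circ l a b"])
  also have "\<dots> = inv\<^bsub>D l\<^esub> (a \<otimes>\<^bsub>D l\<^esub> ?t l a b) \<otimes>\<^bsub>D l\<^esub> (a \<otimes>\<^bsub>D l\<^esub> ?t l a (circ ?m b c))"
    by (simp add: mult_brace_tri[OF l a bc])
  \<comment> \<open>The inverse of the product ends in the inverse of \<open>a\<close>, which
    cancels the following \<open>a\<close>.\<close>
  also have "\<dots> = inv\<^bsub>D l\<^esub> (?t l a b) \<otimes>\<^bsub>D l\<^esub> ?t l a (circ ?m b c)"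
    using carr by (simp add: inv_mult_group m_assoc inv_solve_left' flip: m_assoc[of "inv\<^bsub>D l\<^esub> a" a])
  \<comment> \<open>As a homomorphism, \<open>?t l a\<close> absorbs the inverse and the product,
    both now taken in \<open>D ?m\<close>; what remains inside is the definition of
    \<open>?t ?m b c\<close>.\<close>
  also have "\<dots> = ?t l a (inv\<^bsub>D ?m\<^esub> b \<otimes>\<^bsub>D ?m\<^esub> circ ?m b c)"
    using b bc m t.hom_inv[of b] brace_tri_mult[OF l a _ bc, of "inv\<^bsub>D ?m\<^esub> b"] by (simp add: carrier_D)
  finally show ?thesis
    by (simp add: brace_tri_def[of D circ ?m])
qed

lemma brace_tri_bij:
  assumes "l \<in> \<Lambda>" "a \<in> G"
  shows "bij_betw (brace_tri D circ l a) G G"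
  using bij_betw_trans[OF circ_bij[OF assms] left_translation_bij[of l "inv\<^bsub>D l\<^esub> a"]] assms
  by (simp add: brace_tri_def[abs_def] comp_def)

lemma dynamical_post_group_brace_tri: "dynamical_post_group \<Lambda> G \<phi> D (brace_tri D circ)"
  by unfold_locales (fact brace_tri_closed brace_tri_mult brace_tri_action brace_tri_bij)+

end

text \<open>The new operation is built from inverses, products and \<open>circ\<close>. At each
  fixed \<open>l\<close>, preserving products makes \<open>\<Psi> l\<close> a group homomorphism,
  hence compatible with inverses; the shift to \<open>\<Psi> (\<phi> l a) b\<close> comes from
  \<open>hom_circ\<close>.\<close>

lemma (in dynamical_skew_brace_hom) dynamical_post_group_hom_brace_tri:
  "dynamical_post_group_hom \<Lambda> G \<phi> D (brace_tri D circ) H \<phi>' D' (brace_tri D' circ') \<Psi>"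
proof (intro dynamical_post_group_hom.intro dynamical_post_group_hom_axioms.intro)
  fix l a b
  assume l: "l \<in> \<Lambda>" and a: "a \<in> G" and b: "b \<in> G"
  interpret \<Psi>: group_hom "D l" "D' l" "\<Psi> l"
    using l
    by (intro group_hom.intro group_hom_axioms.intro homI)
      (simp_all add: source.group_D target.group_D source.carrier_D target.carrier_D map_closed hom_mult)
  show "\<Psi> l (brace_tri D circ l a b) = brace_tri D' circ' l (\<Psi> l a) (\<Psi> (\<phi> l a) b)"
    using l a b \<Psi>.hom_inv[of a]
    by (simp add: brace_tri_def hom_mult hom_circ source.circ_closed source.carrier_D)
qed (fact source.dynamical_post_group_brace_tri target.dynamical_post_group_brace_tri
    dynamical_set_morphism_axioms hom_mult)+

theorem proposition5p6:
  fixes \<Lambda> :: "'l set"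
    and G :: "'a set" and \<phi> :: "'l \<Rightarrow> 'a \<Rightarrow> 'l"
    and D :: "'l \<Rightarrow> 'a monoid" and circ :: "'l \<Rightarrow> 'a \<Rightarrow> 'a \<Rightarrow> 'a"
  assumes "dynamical_skew_brace \<Lambda> G \<phi> D circ"
  shows "dynamical_post_group \<Lambda> G \<phi> D (brace_tri D circ) \<and>
    (\<forall>(H :: 'b set) \<phi>' D' circ' \<Psi>.
      dynamical_skew_brace_hom \<Lambda> G \<phi> D circ H \<phi>' D' circ' \<Psi> \<longrightarrow>
      dynamical_post_group_hom \<Lambda> G \<phi> D (brace_tri D circ) H \<phi>' D' (brace_tri D' circ') \<Psi>)"
  using assms dynamical_skew_brace.dynamical_post_group_brace_tri
    dynamical_skew_brace_hom.dynamical_post_group_hom_brace_tri by blast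

end
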